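(* Let $p,n$ be positive integers with $p\geq 2$, and let $\mathcal{L}$ denote the equation $px+y=z$. Then $$f_{\max}(n,\mathcal{L})\geq 3^{\mu_{\mathcal{L}}(n)/3-2pn/(3(p+1)(3p^2-1))-p-5}.$$
   Context: $[n]=\{1,\dots,n\}$. A set $A\subseteq[n]$ is $\mathcal{L}$-free, for $\mathcal{L}$ the equation $px+y=z$ with $p\ge 2$, if there are no $x,y,z\in A$ (not necessarily distinct) with $px+y=z$ (such an equation has no trivial solutions). A set $S\subseteq[n]$ is a maximal $\mathcal{L}$-free subset of $[n]$ if it is $\mathcal{L}$-free and not properly contained in another $\mathcal{L}$-free subset of $[n]$; $f_{\max}(n,\mathcal{L})$ is the number of these. $\mu_{\mathcal{L}}(n)$ is the size of the largest $\mathcal{L}$-free subset of $[n]$. *)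

theory Defs
  imports Complex_Main
begin

text \<open>
  Sets free of solutions to the equation \<open>p x + y = z\<close>. For \<open>p \<ge> 2\<close> this equation has no
  trivial solutions, so every solution in \<open>A\<close> is forbidden; \<open>x\<close>, \<open>y\<close>, \<open>z\<close> need not be distinct.
\<close>

definition L_free :: "nat \<Rightarrow> nat set \<Rightarrow> bool" where
  "L_free p A \<longleftrightarrow> \<not> (\<exists>x\<in>A. \<exists>y\<in>A. \<exists>z\<in>A. p * x + y = z)"

definition maximal_L_free :: "nat \<Rightarrow> nat \<Rightarrow> nat set \<Rightarrow> bool" where
  "maximal_L_free p n S \<longleftrightarrow>
     S \<subseteq> {1..n} \<and> L_free p S \<and> \<not> (\<exists>T. T \<subseteq> {1..n} \<and> L_free p T \<and> S \<subset> T)"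

definition f_max :: "nat \<Rightarrow> nat \<Rightarrow> nat" where
  "f_max n p = card {S. maximal_L_free p n S}"

definition mu :: "nat \<Rightarrow> nat \<Rightarrow> nat" where
  "mu p n = Max {card A | A. A \<subseteq> {1..n} \<and> L_free p A}"

end

theory Submission
  imports Defs "HOL-Library.FuncSet"
begin

text \<open>
  Take \<open>s = \<lfloor>(p - 1) n / (3 p\<^sup>2 - 1)\<rfloor>\<close> and force \<open>s\<close> and \<open>2 s\<close> into the set. Then no two elements of the
  same triple \<open>x, x + p s, x + 2 p s\<close> can be chosen. The triples that fill the interval
  \<open>(a, n]\<close>, \<open>a = n - 3 p s\<close>, do not interact: \<open>s\<close> is small enough that every other solution
  would have to exceed \<open>n\<close>, apart from those with \<open>x\<close> and \<open>y\<close> in \<open>{s, 2 s}\<close>, which affect at most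
  two triples. Picking one element from each remaining triple and extending to a maximal set gives
  pairwise different maximal sets, hence at least \<open>3 ^ (p s - 2)\<close> of them. Finally, if \<open>m\<close> is the
  least element of a solution-free set \<open>A\<close>, then \<open>A\<close> and \<open>A + p m\<close> are disjoint, which bounds \<open>mu\<close>.
\<close>

lemma L_free_subset_maximal:
  assumes "A \<subseteq> {1..n}" "L_free p A"
  obtains M where "maximal_L_free p n M" "A \<subseteq> M"
proof -
  let ?F = "{T. T \<subseteq> {1..n} \<and> L_free p T}"
  have "finite ?F" by (rule finite_subset[of _ "Pow {1..n}"]) auto
  moreover have "A \<in> ?F" using assms by simp
  ultimately obtain M where "M \<in> ?F" "A \<subseteq> M" "\<forall>T\<in>?F. M \<subseteq> T \<longrightarrow> M = T"
    using finite_has_maximal2[of ?F A] by blast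
  then show ?thesis by (intro that[of M]) (auto simp: maximal_L_free_def)
qed

lemma finite_maximal_L_free: "finite {S. maximal_L_free p n S}"
  by (rule finite_subset[of _ "Pow {1..n}"]) (auto simp: maximal_L_free_def)

lemma f_max_pos: "1 \<le> f_max n p"
proof -
  obtain M where "maximal_L_free p n M"
    by (rule L_free_subset_maximal[of "{}" n p]) (auto simp: L_free_def)
  then show ?thesis
    using finite_maximal_L_free[of p n] by (auto simp: f_max_def Suc_le_eq card_gt_0_iff)
qed

lemma card_L_free_le:
  assumes p: "p \<ge> 1" and A: "A \<subseteq> {1..n}" "L_free p A"
  shows "(p + 1) * card A \<le> p * n + p + 1"
proof (cases "A = {}")
  case False
  have fin: "finite A" using A(1) finite_subset by blast
  define m where "m = Min A"
  have m: "m \<in> A" "\<And>x. x \<in> A \<Longrightarrow> m \<le> x" using fin False by (auto simp: m_def)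
  have mn: "1 \<le> m" "m \<le> n" using m(1) A(1) by auto
  have A_sub: "A \<subseteq> {m..n}" using m A by auto
  \<comment> \<open>Two bounds compete: \<open>n - m + 1\<close> from the interval alone, and half
    of \<open>n + (p - 1) * m + 1\<close> from the disjoint translate. They cross near
    \<open>(p + 1) * m = n\<close>.\<close>
  show ?thesis
  proof (cases "(p + 1) * m \<le> n")
    case False
    have "card A + m \<le> n + 1"
      using card_mono[OF _ A_sub] mn by simp
    then have "(p + 1) * (card A + m) \<le> (p + 1) * (n + 1)" by (rule mult_le_mono2)
    then show ?thesis using False by (simp add: algebra_simps)
  next
    case True
    let ?A' = "(\<lambda>y. p * m + y) ` A"
    have "A \<inter> ?A' = {}" using A(2) m(1) by (auto simp: L_free_def)
    then have "2 * card A = card (A \<union> ?A')"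
      by (simp add: card_Un_disjoint fin card_image)
    also have "\<dots> \<le> card {m..n + p * m}"
      using A_sub by (intro card_mono) auto
    finally have "2 * card A + m \<le> n + p * m + 1" using mn by simp
    then have "(p + 1) * (2 * card A + m) \<le> (p + 1) * (n + p * m + 1)" by (rule mult_le_mono2)
    moreover obtain q where "p = Suc q" using p by (cases p) auto
    moreover have "q * ((p + 1) * m) \<le> q * n" using True by (rule mult_le_mono2)
    ultimately show ?thesis by (simp add: algebra_simps)
  qed
qed simp

lemma mu_le:
  assumes "p \<ge> 1"
  shows "(p + 1) * mu p n \<le> p * n + p + 1"
proof -
  let ?C = "{card A | A. A \<subseteq> {1..n} \<and> L_free p A}"
  have "finite ?C" by (rule finite_subset[of _ "card ` Pow {1..n}"]) auto
  moreover have "card {} \<in> ?C" by (intro CollectI exI[of _ "{}"]) (auto simp: L_free_def)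
  ultimately have "mu p n \<in> ?C" unfolding mu_def by (intro Max_in) auto
  then show ?thesis using card_L_free_le[OF assms] by auto
qed

lemma inj_on_mod_interval: "inj_on (\<lambda>x. x mod d) {a + 1..a + d}" for a d :: nat
proof (rule linorder_inj_onI')
  fix x y assume "x \<in> {a + 1..a + d}" "y \<in> {a + 1..a + d}" "x < y"
  then show "x mod d \<noteq> y mod d"
    using mod_eq_dvd_iff_nat[of x y d] by (auto dest!: dvd_imp_le)
qed

text \<open>By \<open>n_le\<close>, \<open>p * (a + 1) + s\<close> exceeds \<open>n\<close>, so no
  solution has \<open>x\<close> above \<open>a\<close>; \<open>2 * s \<le> a\<close> keeps
  \<open>s\<close> and \<open>2 * s\<close> below every triple.\<close>

lemma f_max_ge_triples:
  assumes p: "p \<ge> 2" and s: "s \<ge> 1"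
    and n: "n = a + 3 * (p * s)" and n_le: "n \<le> p * a + s" and a: "2 * s \<le> a"
  shows "3 ^ (p * s - 2) \<le> f_max n p"
proof -
  define d where "d = p * s"
  have d: "d > 0" "2 * s \<le> d" using p s by (auto simp: d_def)
  \<comment> \<open>Least elements of the triples. They are \<open>d\<close> consecutive numbers, so
    a residue modulo \<open>d\<close> identifies its triple.\<close>
  define I where "I = {a + 1..a + d}"
  have inj_I: "inj_on (\<lambda>x. x mod d) I" unfolding I_def by (rule inj_on_mod_interval)
  \<comment> \<open>triples that may contain \<open>p x + y\<close> for some \<open>x\<close>, \<open>y\<close> in \<open>{s, 2 s}\<close>\<close>
  define Bad where "Bad = {x\<in>I. x mod d \<in> {s mod d, (2 * s) mod d}}"
  define R where "R = I - Bad"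
  have "card Bad = card ((\<lambda>x. x mod d) ` Bad)"
    using inj_I by (intro card_image[symmetric]) (auto simp: Bad_def intro: inj_on_subset)
  also have "\<dots> \<le> card {s mod d, (2 * s) mod d}" by (intro card_mono) (auto simp: Bad_def)
  also have "\<dots> \<le> 2" by (simp add: card_insert_if)
  finally have card_R: "d - 2 \<le> card R"
    unfolding R_def by (subst card_Diff_subset) (auto simp: Bad_def I_def)
  have fin_R: "finite R" by (simp add: R_def I_def)
  define F where "F c = {s, 2 * s} \<union> (\<lambda>x. x + c x * d) ` R" for c :: "nat \<Rightarrow> nat"
  \<comment> \<open>Extensional functions are determined by their values on \<open>R\<close>, so
    there are exactly \<open>3 ^ card R\<close> choices.\<close>
  let ?C = "R \<rightarrow>\<^sub>E {..<3::nat}"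
  have F: "F c \<subseteq> {1..n} \<and> L_free p (F c)" if c: "c \<in> ?C" for c
  proof -
    have up: "a < x + c x * d" "x + c x * d \<le> n" if "x \<in> R" for x
    proof -
      have "c x \<le> 2" using PiE_mem[OF c that] by simp
      then have "c x * d \<le> 2 * d" by (rule mult_le_mono1)
      moreover have "a < x" "x \<le> a + d" using that by (auto simp: R_def I_def)
      ultimately show "a < x + c x * d" "x + c x * d \<le> n" using n[folded d_def] by linarith+
    qed
    have bounds: "s \<le> x" "x \<le> n" if "x \<in> F c" for x
      using that up a n d by (fastforce simp: F_def d_def)+
    have False if xyz: "x \<in> F c" "y \<in> F c" "z \<in> F c" "p * x + y = z" for x y z
    proof -
      have "2 * s \<le> p * x" using p bounds(1)[OF xyz(1)] by (rule mult_le_mono)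
      then have "2 * s < z" using bounds(1)[OF xyz(2)] xyz(4) s by linarith
      then obtain w where w: "w \<in> R" "z = w + c w * d" using xyz(3) by (auto simp: F_def)
      have "x \<in> {s, 2 * s}"
      proof (rule ccontr)
        assume "x \<notin> {s, 2 * s}"
        then have "a + 1 \<le> x" using xyz(1) up by (force simp: F_def)
        then have "p * (a + 1) \<le> p * x" by (rule mult_le_mono2)
        then show False
          using n_le bounds(1)[OF xyz(2)] bounds(2)[OF xyz(3)] xyz(4) p by simp
      qed
      \<comment> \<open>Now \<open>p * x\<close> is a multiple of \<open>d\<close>, so
        \<open>y\<close> and \<open>z\<close> agree modulo \<open>d\<close>: a small
        \<open>y\<close> would put \<open>z\<close> in a bad triple, and a large \<open>y\<close>
        lies in the triple of \<open>z\<close>, where only one element was chosen.\<close>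
      then have "p * x = 1 * d \<or> p * x = 2 * d" by (auto simp: d_def)
      then obtain k where k: "k \<ge> 1" "p * x = k * d" by (metis order_refl one_le_numeral)
      have "z = k * d + y" using xyz(4) k(2) by simp
      then have "z mod d = y mod d" by simp
      then have wy: "w mod d = y mod d" using w by simp
      show False
      proof (cases "y \<in> {s, 2 * s}")
        case True
        then show False using wy w(1) by (auto simp: R_def Bad_def)
      next
        case False
        then obtain v where v: "v \<in> R" "y = v + c v * d" using xyz(2) by (auto simp: F_def)
        then have "w mod d = v mod d" using wy by simp
        then have "w = v" using inj_I w(1) v(1) by (auto simp: R_def dest: inj_onD)
        then have "z = y" using w v by simp
        then show False using xyz(4) k d by simp
      qed
    qed
    moreover have "F c \<subseteq> {1..n}" using bounds s by fastforce
    ultimately show ?thesis unfolding L_free_def by blast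
  qed
  have "\<forall>c\<in>?C. \<exists>M. maximal_L_free p n M \<and> F c \<subseteq> M"
    using F by (metis L_free_subset_maximal)
  then obtain M where M: "\<And>c. c \<in> ?C \<Longrightarrow> maximal_L_free p n (M c) \<and> F c \<subseteq> M c"
    by metis
  \<comment> \<open>Differences inside a triple are \<open>p * s\<close> and
    \<open>p * (2 * s)\<close>. Hence whatever else \<open>M c\<close> gains, it meets each triple
    in \<open>R\<close> only in the chosen element, and \<open>c\<close> can be recovered.\<close>
  have no_two: False
    if T: "L_free p T" "s \<in> T" "2 * s \<in> T" and ij: "x + i * d \<in> T" "x + j * d \<in> T" "i < j" "j < 3"
    for T x i j
  proof -
    have "j = i + 1 \<or> j = i + 2" using ij by auto
    then have "p * s + (x + i * d) = x + j * d \<or> p * (2 * s) + (x + i * d) = x + j * d"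
      by (auto simp: d_def algebra_simps)
    then show False using T ij unfolding L_free_def by blast
  qed
  have "inj_on M ?C"
  proof (rule inj_onI)
    fix c c' assume c: "c \<in> ?C" and c': "c' \<in> ?C" and eq: "M c = M c'"
    show "c = c'"
    proof (rule PiE_ext[OF c c'])
      fix x assume x: "x \<in> R"
      have "s \<in> M c" "2 * s \<in> M c" "x + c x * d \<in> M c" "x + c' x * d \<in> M c"
        using M[OF c] M[OF c'] x eq by (auto simp: F_def)
      moreover have "L_free p (M c)" using M[OF c] by (simp add: maximal_L_free_def)
      moreover have "c x < 3" "c' x < 3" using c c' x by auto
      ultimately show "c x = c' x" using no_two by (metis linorder_neqE_nat)
    qed
  qed
  then have "card ?C = card (M ` ?C)" by (simp add: card_image)
  also have "\<dots> \<le> f_max n p"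
    unfolding f_max_def using M by (intro card_mono finite_maximal_L_free) auto
  finally have le: "3 ^ card R \<le> f_max n p" by (simp add: card_funcsetE fin_R)
  have "(3::nat) ^ (d - 2) \<le> 3 ^ card R" using card_R by (intro power_increasing) auto
  also note le
  finally show ?thesis unfolding d_def .
qed

text \<open>With \<open>a = n - 3 * p * s\<close>, the condition \<open>n \<le> p * a + s\<close>
  rearranges to \<open>s * (3 * p\<^sup>2 - 1) \<le> (p - 1) * n\<close>; the quotient is the
  largest such \<open>s\<close>.\<close>

lemma f_max_ge_power:
  assumes p: "p \<ge> 2"
  shows "3 ^ (p * ((p - 1) * n div (3 * p\<^sup>2 - 1)) - 2) \<le> f_max n p"
proof -
  define s where "s = (p - 1) * n div (3 * p\<^sup>2 - 1)"
  have "s * (3 * p\<^sup>2 - 1) \<le> (p - 1) * n" unfolding s_def by (rule div_times_less_eq_dividend)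
  moreover obtain q where q: "p = Suc q" "q \<ge> 1" using p by (cases p) auto
  ultimately have le: "q * (3 * (p * s)) + (3 * p - 1) * s \<le> q * n"
    by (simp add: algebra_simps power2_eq_square)
  show ?thesis
  proof (cases "s = 0")
    \<comment> \<open>The exponent truncates to 0, so a single maximal set suffices.\<close>
    case True
    then show ?thesis using f_max_pos[of n p] by (simp add: s_def)
  next
    case False
    have "q * (3 * (p * s)) \<le> q * n" using le by linarith
    then have "3 * (p * s) \<le> n" using q by simp
    then obtain a where a: "n = a + 3 * (p * s)" by (metis add.commute le_Suc_ex)
    have qa: "(3 * p - 1) * s \<le> q * a" using le by (simp add: a algebra_simps)
    have "q * (2 * s) \<le> (3 * p - 1) * s" using q by (simp add: algebra_simps)
    then have "2 * s \<le> a" using qa q by (meson le_trans mult_le_cancel1 less_le_trans zero_less_one)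
    moreover have "n \<le> p * a + s" using qa q by (simp add: a algebra_simps)
    ultimately show ?thesis
      using f_max_ge_triples[OF p _ a] False unfolding s_def[symmetric] by simp
  qed
qed

theorem proposition21:
  fixes p n :: nat
  assumes "p \<ge> 2" and "n \<ge> 1"
  shows "real (f_max n p) \<ge>
    3 powr (real (mu p n) / 3
            - 2 * real p * real n / (3 * (real p + 1) * (3 * (real p)\<^sup>2 - 1))
            - real p - 5)"
proof -
  define D where "D = 3 * p\<^sup>2 - 1"
  define s where "s = (p - 1) * n div D"
  define P where "P = real p"
  define N where "N = real n"
  define E where "E = 3 * P\<^sup>2 - 1"
  have P: "P \<ge> 2" using assms by (simp add: P_def)
  then have "P\<^sup>2 \<ge> 2\<^sup>2" by (intro power_mono) auto
  then have E: "E > 0" by (simp add: E_def)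
  have "p\<^sup>2 \<ge> 1" using assms by simp
  then have D: "D > 0" "real D = E" by (auto simp: D_def E_def P_def of_nat_diff)
  have "(p - 1) * n \<le> s * D + D"
    unfolding s_def using D(1) by (metis div_mult_mod_eq mod_less_divisor nat_add_left_cancel_le less_imp_le)
  then have "real ((p - 1) * n) \<le> real (s * D + D)" by (rule of_nat_mono)
  then have "(P - 1) * N \<le> (real s + 1) * E"
    using assms by (simp add: D P_def N_def of_nat_diff algebra_simps)
  then have "(P - 1) * N / E \<le> real s + 1" using E by (simp add: divide_le_eq)
  then have "P * ((P - 1) * N / E) \<le> P * (real s + 1)" using P by (intro mult_left_mono) auto
  then have s_ge: "P * (P - 1) * N / E - P \<le> real (p * s)"
    by (simp add: P_def algebra_simps)
  \<comment> \<open>Losses in the exponent: 1/3 from the bound on \<open>mu\<close>,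
    \<open>P\<close> from rounding \<open>s\<close> down, 2 from the bad triples. Together they stay
    below \<open>P + 5\<close>.\<close>
  have arith: "m / 3 - v - P - 5 \<le> real (k - 2)"
    if "m \<le> u + 1" "u / 3 - v = w" "w - P \<le> real k" for m u v w :: real and k
    using that by linarith
  have "real ((p + 1) * mu p n) \<le> real (p * n + p + 1)"
    using assms by (intro of_nat_mono mu_le) auto
  then have "real (mu p n) \<le> P * N / (P + 1) + 1"
    using P by (simp add: P_def N_def field_simps)
  \<comment> \<open>The subtracted fraction is exactly the gap between a third of the leading term
    bounding \<open>mu\<close> and the unrounded value of \<open>p * s\<close>.\<close>
  moreover have "P * N / (P + 1) / 3 - 2 * P * N / (3 * (P + 1) * E) = P * (P - 1) * N / E"
  proof -
    have "P * N / (P + 1) / 3 = P * N * E / (3 * (P + 1) * E)"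
      using E by (simp add: mult.commute)
    then have "P * N / (P + 1) / 3 - 2 * P * N / (3 * (P + 1) * E)
        = P * N * (E - 2) / (3 * (P + 1) * E)"
      by (simp add: diff_divide_distrib[symmetric] algebra_simps)
    also have "E - 2 = 3 * (P + 1) * (P - 1)" by (simp add: E_def power2_eq_square algebra_simps)
    also have "P * N * (3 * (P + 1) * (P - 1)) = 3 * (P + 1) * (P * (P - 1) * N)" by simp
    also have "\<dots> / (3 * (P + 1) * E) = P * (P - 1) * N / E"
      using P by (intro mult_divide_mult_cancel_left) simp
    finally show ?thesis .
  qed
  ultimately have "real (mu p n) / 3 - 2 * P * N / (3 * (P + 1) * E) - P - 5 \<le> real (p * s - 2)"
    using s_ge by (rule arith)
  then have "3 powr (real (mu p n) / 3 - 2 * P * N / (3 * (P + 1) * E) - P - 5)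
      \<le> 3 powr real (p * s - 2)"
    by (rule powr_mono) simp
  also have "\<dots> = real (3 ^ (p * s - 2))" by (simp add: powr_realpow)
  also have "\<dots> \<le> real (f_max n p)"
    using f_max_ge_power[OF assms(1)] unfolding s_def D_def by (rule of_nat_mono)
  finally show ?thesis unfolding P_def N_def E_def .
qed

end
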